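(* Let $k$ be a field, let $G$ be a finite simple graph without isolated vertices, with nonempty vertex set $V(G)=\{x_1,\dots,x_n\}$ and with $p$ connected components, let $R=k[x_1,\dots,x_n]$, and let $I=I(G)\subseteq R$ be the edge ideal of $G$. For $1\le i\le p$ let $d_i$ be the diameter of the $i$-th connected component of $G$, and let $d=\max_i d_i$ be the diameter of $G$. Then $$\operatorname{depth} R/I\ \geq\ \sum_{i=1}^{p}\left\lceil \frac{d_i+1}{3}\right\rceil .$$ In particular, $$\operatorname{depth} R/I\ \geq\ \left\lceil \frac{d+1}{3}\right\rceil+p-1 .$$
   Context: Simple graph: no loops and no multiple edges. Vertices of $G$ are identified with the variables of $R$. The edge ideal $I(G)$ is the ideal of $R$ generated by the monomials $x_ix_j$ with $\{x_i,x_j\}\in E(G)$. The diameter of a connected graph is the maximum of the distances $d(u,v)$ (length of a shortest path) over all pairs of vertices; the diameter of a disconnected graph means the maximum of the diameters of its connected components. $\operatorname{depth} R/I$ is the maximum length of an $R/I$-regular sequence in $\mathfrak m=(x_1,\dots,x_n)$. *)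

theory Defs
  imports Complex_Main "HOL-Library.Poly_Mapping" "HOL-Library.Extended_Nat"
begin

section \<open>Finite simple graphs\<close>

text \<open>
  The vertex set of a graph is the whole of a type \<open>'v\<close> (of class \<open>finite\<close> in the applications,
  hence finite and nonempty); a graph is given by its set of edges, which are two-element sets.
\<close>

definition simple_graph :: "'v set set \<Rightarrow> bool"
  where "simple_graph E \<longleftrightarrow> (\<forall>e\<in>E. card e = 2)"

definition no_isolated_vertices :: "'v set set \<Rightarrow> bool"
  where "no_isolated_vertices E \<longleftrightarrow> (\<forall>v. \<exists>e\<in>E. v \<in> e)"

text \<open>A path is given by its list of vertices; its length is the number of its edges.\<close>

definition graph_path :: "'v set set \<Rightarrow> 'v \<Rightarrow> 'v list \<Rightarrow> 'v \<Rightarrow> bool"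
  where "graph_path E u p v \<longleftrightarrow>
    p \<noteq> [] \<and> hd p = u \<and> last p = v \<and> distinct p \<and> successively (\<lambda>x y. {x, y} \<in> E) p"

definition path_length :: "'v list \<Rightarrow> nat"
  where "path_length p = length p - 1"

definition graph_dist :: "'v set set \<Rightarrow> 'v \<Rightarrow> 'v \<Rightarrow> nat"
  where "graph_dist E u v = (LEAST l. \<exists>p. graph_path E u p v \<and> path_length p = l)"

definition components :: "'v set set \<Rightarrow> 'v set set"
  where "components E = UNIV // {(u, v). \<exists>p. graph_path E u p v}"

text \<open>
  For a connected component \<open>C\<close>, distances in \<open>C\<close> and in the whole graph agree, as every path
  between vertices of \<open>C\<close> stays inside \<open>C\<close>.
\<close>

definition component_diameter :: "'v set set \<Rightarrow> 'v set \<Rightarrow> nat"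
  where "component_diameter E C = Max {graph_dist E u v | u v. u \<in> C \<and> v \<in> C}"

definition graph_diameter :: "'v set set \<Rightarrow> nat"
  where "graph_diameter E = Max (component_diameter E ` components E)"


section \<open>Polynomial rings, edge ideals and depth\<close>

text \<open>
  \<open>('v, 'k) mpoly\<close> is the polynomial ring over \<open>'k\<close> with one variable for each element of \<open>'v\<close>:
  finitely supported functions from exponent vectors to coefficients, with convolution product.
\<close>

type_synonym ('v, 'k) mpoly = "('v \<Rightarrow>\<^sub>0 nat) \<Rightarrow>\<^sub>0 'k"

definition var :: "'v \<Rightarrow> ('v, 'k::comm_ring_1) mpoly"
  where "var v = Poly_Mapping.single (Poly_Mapping.single v 1) 1"

text \<open>The ideal generated by a set is its span in the ring seen as a module over itself.\<close>

lemma module_times: "module ((*) :: 'a::comm_ring_1 \<Rightarrow> 'a \<Rightarrow> 'a)"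
  by unfold_locales (simp_all add: algebra_simps)

definition ideal_gen :: "'a::comm_ring_1 set \<Rightarrow> 'a set"
  where "ideal_gen B = module.span (*) B"

definition edge_ideal :: "'v set set \<Rightarrow> ('v, 'k::comm_ring_1) mpoly set"
  where "edge_ideal E = ideal_gen {var u * var v | u v. {u, v} \<in> E}"

definition maximal_ideal :: "('v, 'k::comm_ring_1) mpoly set"
  where "maximal_ideal = ideal_gen (range var)"

text \<open>
  For \<open>M = R/I\<close> the module \<open>M/(f\<^sub>1,\<dots>,f\<^sub>i)M\<close> is \<open>R/J\<close> with \<open>J = I + (f\<^sub>1,\<dots>,f\<^sub>i)\<close>,
  and \<open>f\<close> is a nonzerodivisor on \<open>R/J\<close> iff \<open>f * g \<in> J\<close> implies \<open>g \<in> J\<close>. The last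
  conjunct says \<open>M \<noteq> (f\<^sub>1,\<dots>,f\<^sub>r)M\<close>.
\<close>

definition quotient_regular_sequence :: "'a::comm_ring_1 set \<Rightarrow> 'a list \<Rightarrow> bool"
  where "quotient_regular_sequence I fs \<longleftrightarrow>
    (\<forall>i<length fs. \<forall>g. fs ! i * g \<in> ideal_gen (I \<union> set (take i fs))
        \<longrightarrow> g \<in> ideal_gen (I \<union> set (take i fs))) \<and>
    ideal_gen (I \<union> set fs) \<noteq> UNIV"

text \<open>
  \<open>quotient_depth I\<close> is the depth of \<open>R/I\<close> with respect to \<open>(x\<^sub>1,\<dots>,x\<^sub>n)\<close>. The supremum is
  taken in \<^typ>\<open>enat\<close>, where it is a maximum whenever it is finite.
\<close>

definition quotient_depth :: "('v, 'k::comm_ring_1) mpoly set \<Rightarrow> enat"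
  where "quotient_depth I =
    Sup {enat (length fs) | fs. set fs \<subseteq> maximal_ideal \<and> quotient_regular_sequence I fs}"

end

theory Submission
  imports Defs "HOL-Library.Disjoint_Sets"
begin

text \<open>
  If the closed neighbourhoods \<open>N[a]\<close>, \<open>a \<in> A\<close>, are pairwise disjoint, then the linear forms
  \<open>\<Sum>v\<in>N[a]. x\<^sub>v\<close> form a regular sequence on \<open>R/I(G)\<close>: repeatedly replacing \<open>J\<close> by \<open>J : x\<^sub>b\<close> and
  \<open>(J, x\<^sub>b)\<close> reduces to ideals for which each form contains a variable occurring neither in the
  generators of the ideal nor in the other forms. On a geodesic of length \<open>d\<close>, every third vertex
  gives \<open>\<lceil>(d + 1) / 3\<rceil>\<close> vertices at pairwise distance at least \<open>3\<close>, whose closed neighbourhoods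
  are therefore disjoint; the packings of different components combine.
\<close>

section \<open>Ideals and weakly regular sequences\<close>

lemma ideal_gen_base: "b \<in> B \<Longrightarrow> b \<in> ideal_gen B"
  unfolding ideal_gen_def by (rule module.span_base[OF module_times])

lemma ideal_gen_0: "0 \<in> ideal_gen B"
  unfolding ideal_gen_def by (rule module.span_zero[OF module_times])

lemma ideal_gen_add: "f \<in> ideal_gen B \<Longrightarrow> g \<in> ideal_gen B \<Longrightarrow> f + g \<in> ideal_gen B"
  unfolding ideal_gen_def by (rule module.span_add[OF module_times])

lemma ideal_gen_diff: "f \<in> ideal_gen B \<Longrightarrow> g \<in> ideal_gen B \<Longrightarrow> f - g \<in> ideal_gen B"
  unfolding ideal_gen_def by (rule module.span_diff[OF module_times])

lemma ideal_gen_mult: "f \<in> ideal_gen B \<Longrightarrow> r * f \<in> ideal_gen B"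
  unfolding ideal_gen_def by (rule module.span_scale[OF module_times])

lemma ideal_gen_sum: "(\<And>i. i \<in> S \<Longrightarrow> f i \<in> ideal_gen B) \<Longrightarrow> sum f S \<in> ideal_gen B"
  unfolding ideal_gen_def by (rule module.span_sum[OF module_times])

lemma ideal_gen_mono: "A \<subseteq> B \<Longrightarrow> ideal_gen A \<subseteq> ideal_gen B"
  unfolding ideal_gen_def by (rule module.span_mono[OF module_times])

lemma ideal_gen_subset: "A \<subseteq> ideal_gen B \<Longrightarrow> ideal_gen A \<subseteq> ideal_gen B"
  unfolding ideal_gen_def by (metis module.span_mono[OF module_times] module.span_span[OF module_times])

lemma ideal_gen_insert: "h \<in> ideal_gen (insert a B) \<longleftrightarrow> (\<exists>r. h - r * a \<in> ideal_gen B)"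
  unfolding ideal_gen_def by (simp add: module.span_insert[OF module_times])

lemma ideal_gen_induct [consumes 1, case_names zero add mult]:
  assumes "f \<in> ideal_gen B" and "P 0" and "\<And>f g. P f \<Longrightarrow> P g \<Longrightarrow> P (f + g)"
    and "\<And>r b. b \<in> B \<Longrightarrow> P (r * b)"
  shows "P f"
proof (rule module.span_induct_alt[OF module_times, where h = P and S = B and x = f])
  show "f \<in> module.span (*) B"
    using assms(1) by (simp add: ideal_gen_def)
qed (use assms(2-) in auto)

text \<open>The nonzerodivisor half of regularity. Earlier sequence elements accumulate in
  \<open>B\<close>, so induction on the list replaces the prefixes \<open>take i fs\<close>;
  properness of the final ideal is verified separately.\<close>

fun weakly_regular :: "'a::comm_ring_1 set \<Rightarrow> 'a list \<Rightarrow> bool"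
  where
    "weakly_regular B [] \<longleftrightarrow> True"
  | "weakly_regular B (f # fs) \<longleftrightarrow>
      (\<forall>g. f * g \<in> ideal_gen B \<longrightarrow> g \<in> ideal_gen B) \<and> weakly_regular (insert f B) fs"

lemma weakly_regular_nth:
  assumes "weakly_regular B fs" "i < length fs" "fs ! i * g \<in> ideal_gen (B \<union> set (take i fs))"
  shows "g \<in> ideal_gen (B \<union> set (take i fs))"
  using assms
proof (induction fs arbitrary: B i)
  case (Cons f fs)
  show ?case
  proof (cases i)
    case 0
    then show ?thesis
      using Cons.prems by simp
  next
    case (Suc j)
    then have eq: "B \<union> set (take i (f # fs)) = insert f B \<union> set (take j fs)"
      by auto
    show ?thesis
      unfolding eq
      by (rule Cons.IH) (use Cons.prems Suc eq in simp_all)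
  qed
qed simp

text \<open>Regularity depends only on the ideal, so generators may be exchanged for others in which
  chosen variables do not occur.\<close>

lemma weakly_regular_cong:
  assumes "ideal_gen B = ideal_gen C"
  shows "weakly_regular B fs \<longleftrightarrow> weakly_regular C fs"
  using assms
proof (induction fs arbitrary: B C)
  case (Cons f fs)
  have "ideal_gen (insert f B) = ideal_gen (insert f C)"
    using Cons.prems by (simp add: set_eq_iff ideal_gen_insert)
  from Cons.IH[OF this] Cons.prems show ?case
    by simp
qed simp

text \<open>
  In the exact sequence \<open>0 \<rightarrow> R/(J:x) \<rightarrow> R/J \<rightarrow> R/(J,x) \<rightarrow> 0\<close>, a sequence that is weakly regular
  on both outer modules is weakly regular on the middle one.
\<close>

lemma weakly_regular_colon:
  assumes "weakly_regular C fs" and "weakly_regular (insert x B) fs"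
    and "ideal_gen C = {h. x * h \<in> ideal_gen B}"
  shows "weakly_regular B fs"
  using assms
proof (induction fs arbitrary: B C)
  case (Cons f fs)
  have reg_C: "r \<in> ideal_gen C" if "f * r \<in> ideal_gen C" for r
    using Cons.prems(1) that by auto
  have reg_x: "r \<in> ideal_gen (insert x B)" if "f * r \<in> ideal_gen (insert x B)" for r
    using Cons.prems(2) that by auto
  have colon: "h \<in> ideal_gen C \<longleftrightarrow> x * h \<in> ideal_gen B" for h
    using Cons.prems(3) by auto
  have "g \<in> ideal_gen B" if fg: "f * g \<in> ideal_gen B" for g
  proof -
    have "f * g \<in> ideal_gen (insert x B)"
      using fg ideal_gen_mono[of B "insert x B"] by auto
    then obtain r where r: "g - r * x \<in> ideal_gen B"
      using reg_x ideal_gen_insert by blast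
    \<comment> \<open>Let J be the ideal of \<open>B\<close>. Since g = r x modulo J, the product x
      f r lies in J, so f r lies in J : x, where f can be cancelled.\<close>
    have "f * g - f * (g - r * x) \<in> ideal_gen B"
      by (rule ideal_gen_diff[OF fg ideal_gen_mult[OF r]])
    then have "x * (f * r) \<in> ideal_gen B"
      by (simp add: algebra_simps)
    then have "x * r \<in> ideal_gen B"
      using reg_C colon by blast
    from ideal_gen_add[OF r this] show ?thesis
      by (simp add: algebra_simps)
  qed
  moreover have "weakly_regular (insert f B) fs"
  proof (rule Cons.IH)
    show "weakly_regular (insert f C) fs" "weakly_regular (insert x (insert f B)) fs"
      using Cons.prems by (simp_all add: insert_commute)
    \<comment> \<open>The colon by x commutes with adding f, which passes the hypothesis on to the
      tail of the sequence.\<close>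
    show "ideal_gen (insert f C) = {h. x * h \<in> ideal_gen (insert f B)}"
    proof (intro set_eqI iffI CollectI; (elim CollectE)?)
      fix h assume "h \<in> ideal_gen (insert f C)"
      then obtain r where "x * (h - r * f) \<in> ideal_gen B"
        using ideal_gen_insert colon by metis
      then have "x * h - (x * r) * f \<in> ideal_gen B"
        by (simp add: algebra_simps)
      then show "x * h \<in> ideal_gen (insert f B)"
        using ideal_gen_insert by blast
    next
      fix h assume "x * h \<in> ideal_gen (insert f B)"
      then obtain r where r: "x * h - r * f \<in> ideal_gen B"
        using ideal_gen_insert by blast
      \<comment> \<open>The relation x h = r f modulo J puts f r in (J, x). There f is regular, so r
        = s x modulo J, and x (h - s f) lies in J.\<close>
      have "f * r - h * x = (-1) * (x * h - r * f)"
        by (simp add: algebra_simps)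
      then have "f * r - h * x \<in> ideal_gen B"
        using ideal_gen_mult[OF r] by metis
      then obtain s where s: "r - s * x \<in> ideal_gen B"
        using reg_x ideal_gen_insert by blast
      have "(x * h - r * f) + f * (r - s * x) \<in> ideal_gen B"
        by (rule ideal_gen_add[OF r ideal_gen_mult[OF s]])
      then have "x * (h - s * f) \<in> ideal_gen B"
        by (simp add: algebra_simps)
      then show "h \<in> ideal_gen (insert f C)"
        using ideal_gen_insert colon by blast
    qed
  qed
  ultimately show ?case
    by simp
qed simp


section \<open>Coefficients with respect to one variable\<close>

lemma finite_support_shift:
  fixes h :: "'a::cancel_semigroup_add \<Rightarrow> 'b::zero"
  assumes "finite {m. h m \<noteq> 0}"
  shows "finite {m. (if P m then h (m + s) else 0) \<noteq> 0}"
proof (rule finite_subset)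
  show "finite ((\<lambda>m. m + s) -` {m. h m \<noteq> 0})"
    by (rule finite_vimageI[OF assms]) (auto intro: injI)
qed auto

text \<open>The coefficient of \<open>y^n\<close> when \<open>h\<close> is read as a polynomial in
  \<open>y\<close> over the remaining variables; hence only exponent vectors \<open>m\<close>
  without \<open>y\<close> are kept.\<close>

definition coeff_at :: "'v \<Rightarrow> nat \<Rightarrow> ('v, 'k::comm_ring_1) mpoly \<Rightarrow> ('v, 'k) mpoly"
  where "coeff_at y n h = Abs_poly_mapping
    (\<lambda>m. if Poly_Mapping.lookup m y = 0 then Poly_Mapping.lookup h (m + Poly_Mapping.single y n) else 0)"

lemma lookup_coeff_at: "Poly_Mapping.lookup (coeff_at y n h) m =
    (if Poly_Mapping.lookup m y = 0 then Poly_Mapping.lookup h (m + Poly_Mapping.single y n) else 0)"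
  unfolding coeff_at_def
  by (subst lookup_Abs_poly_mapping) (rule finite_support_shift, simp_all)

lemma coeff_at_0 [simp]: "coeff_at y n 0 = 0"
  by (rule poly_mapping_eqI) (simp add: lookup_coeff_at)

lemma coeff_at_add: "coeff_at y n (f + g) = coeff_at y n f + coeff_at y n g"
  by (rule poly_mapping_eqI) (simp add: lookup_coeff_at lookup_add)

text \<open>Subtraction of exponents is truncated, so the difference alone does not determine
  \<open>l\<close>; the exponent of \<open>y\<close> has to be recorded too.\<close>

lemma monomial_eq_add_single_iff:
  fixes l m :: "'v \<Rightarrow>\<^sub>0 nat"
  assumes "Poly_Mapping.lookup m y = 0"
  shows "l = m + Poly_Mapping.single y n \<longleftrightarrow> Poly_Mapping.lookup l y = n \<and> l - Poly_Mapping.single y n = m"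
  using assms
  by (auto simp: poly_mapping_eq_iff fun_eq_iff lookup_add lookup_minus lookup_single when_def)

lemma coeff_at_single:
  "coeff_at y n (Poly_Mapping.single l c) =
    (if Poly_Mapping.lookup l y = n then Poly_Mapping.single (l - Poly_Mapping.single y n) c else 0)"
proof (rule poly_mapping_eqI)
  fix m
  show "Poly_Mapping.lookup (coeff_at y n (Poly_Mapping.single l c)) m = Poly_Mapping.lookup
    (if Poly_Mapping.lookup l y = n then Poly_Mapping.single (l - Poly_Mapping.single y n) c else 0) m"
    by (cases "Poly_Mapping.lookup m y = 0")
      (auto simp: lookup_coeff_at lookup_single when_def monomial_eq_add_single_iff lookup_minus)
qed

lemma mpoly_induct [case_names zero single add]:
  fixes h :: "('v, 'k::comm_ring_1) mpoly"
  assumes "P 0" "\<And>m c. P (Poly_Mapping.single m c)" "\<And>f g. P f \<Longrightarrow> P g \<Longrightarrow> P (f + g)"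
  shows "P h"
proof (induction h rule: update_induct)
  case (update f m c)
  have "Poly_Mapping.update m c f = f + Poly_Mapping.single m c"
    using update(1) by (intro poly_mapping_eqI)
      (auto simp: lookup_update lookup_add lookup_single when_def in_keys_iff)
  then show ?case
    using update assms by simp
qed (rule assms(1))

lemma coeff_at_var_mult:
  assumes "z \<noteq> y"
  shows "coeff_at y n (var z * h) = var z * coeff_at y n h"
proof (induction h rule: mpoly_induct)
  case (single m c)
  have "Poly_Mapping.single z 1 + m - Poly_Mapping.single y n
      = Poly_Mapping.single z 1 + (m - Poly_Mapping.single y n)"
    using assms by (auto simp: poly_mapping_eq_iff fun_eq_iff lookup_add lookup_minus lookup_single when_def)
  then show ?case
    using assms by (simp add: var_def mult_single coeff_at_single lookup_add lookup_single)
qed (simp_all add: coeff_at_add algebra_simps)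

lemma coeff_at_Suc_var_mult: "coeff_at y (Suc n) (var y * h) = coeff_at y n h"
proof (induction h rule: mpoly_induct)
  case (single m c)
  have "Poly_Mapping.single y 1 + m - Poly_Mapping.single y (Suc n) = m - Poly_Mapping.single y n"
    by (auto simp: poly_mapping_eq_iff fun_eq_iff lookup_add lookup_minus lookup_single when_def)
  then show ?case
    by (simp add: var_def mult_single coeff_at_single lookup_add lookup_single)
qed (simp_all add: coeff_at_add algebra_simps)

lemma var_power: "var y ^ n = Poly_Mapping.single (Poly_Mapping.single y n) 1"
  by (induction n) (simp_all add: var_def mult_single flip: single_add)

text \<open>Allowing every bound \<open>M\<close> from \<open>N\<close> on lets two expansions be
  cut off at a common bound when adding. The vanishing coefficient at the bound later starts a
  descending induction.\<close>

lemma coeff_at_expansion: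
  "\<exists>N. \<forall>M\<ge>N. coeff_at y M h = 0 \<and> h = (\<Sum>n<M. var y ^ n * coeff_at y n h)"
proof (induction h rule: mpoly_induct)
  case (single m c)
  have "Poly_Mapping.single y (Poly_Mapping.lookup m y) + (m - Poly_Mapping.single y (Poly_Mapping.lookup m y)) = m"
    by (auto simp: poly_mapping_eq_iff fun_eq_iff lookup_add lookup_minus lookup_single when_def)
  then have "var y ^ n * coeff_at y n (Poly_Mapping.single m c)
      = (if n = Poly_Mapping.lookup m y then Poly_Mapping.single m c else 0)" for n
    by (auto simp: var_power coeff_at_single mult_single)
  then show ?case
    by (intro exI[of _ "Suc (Poly_Mapping.lookup m y)"]) (auto simp: coeff_at_single)
next
  case (add f g)
  then obtain N N' where
    "\<forall>M\<ge>N. coeff_at y M f = 0 \<and> f = (\<Sum>n<M. var y ^ n * coeff_at y n f)"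
    "\<forall>M\<ge>N'. coeff_at y M g = 0 \<and> g = (\<Sum>n<M. var y ^ n * coeff_at y n g)"
    by blast
  then show ?case
    by (intro exI[of _ "max N N'"]) (simp add: coeff_at_add distrib_left sum.distrib)
qed simp

section \<open>Polynomials not involving a given variable\<close>

text \<open>Expresses that \<open>y\<close> does not occur in \<open>f\<close> as linearity of
  coefficient extraction over \<open>f\<close> (take \<open>h = 1\<close> for the converse). In this
  form, closure under sums and products is immediate.\<close>

definition free_of :: "'v \<Rightarrow> ('v, 'k::comm_ring_1) mpoly \<Rightarrow> bool"
  where "free_of y f \<longleftrightarrow> (\<forall>n h. coeff_at y n (f * h) = f * coeff_at y n h)"

lemma free_of_var: "z \<noteq> y \<Longrightarrow> free_of y (var z)"
  by (simp add: free_of_def coeff_at_var_mult)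

lemma free_of_add: "free_of y f \<Longrightarrow> free_of y g \<Longrightarrow> free_of y (f + g)"
  by (simp add: free_of_def distrib_right coeff_at_add)

lemma free_of_mult: "free_of y f \<Longrightarrow> free_of y g \<Longrightarrow> free_of y (f * g)"
  by (simp add: free_of_def mult.assoc)

lemma free_of_sum: "(\<And>i. i \<in> S \<Longrightarrow> free_of y (f i)) \<Longrightarrow> free_of y (sum f S)"
  by (induction S rule: infinite_finite_induct)
    (auto simp: free_of_def coeff_at_add distrib_right)

text \<open>An ideal with generators free of \<open>y\<close> is extended from the ring without
  \<open>y\<close>, so it contains the coefficients of its members.\<close>

lemma coeff_at_in_ideal_gen:
  assumes "\<And>b. b \<in> B \<Longrightarrow> free_of y b" and "h \<in> ideal_gen B"
  shows "coeff_at y n h \<in> ideal_gen B"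
  using assms(2)
proof (induction rule: ideal_gen_induct)
  case (mult r b)
  then have "coeff_at y n (r * b) = coeff_at y n r * b"
    using assms(1) by (metis free_of_def mult.commute)
  then show ?case
    using mult by (simp add: ideal_gen_base ideal_gen_mult)
qed (simp_all add: ideal_gen_0 coeff_at_add ideal_gen_add)

text \<open>The form is monic of degree one in \<open>y\<close>. Writing \<open>h_n\<close> for the
  coefficients of \<open>h\<close>, that of \<open>y^(n+1)\<close> in the product is
  \<open>h_n + g h_(n+1)\<close>. Since \<open>h_N = 0\<close>, descending induction puts every
  \<open>h_n\<close> into the ideal.\<close>

lemma var_plus_free_regular:
  assumes B: "\<And>b. b \<in> B \<Longrightarrow> free_of y b" and "free_of y g"
    and "(var y + g) * h \<in> ideal_gen B"
  shows "h \<in> ideal_gen B"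
proof -
  obtain N where N: "\<forall>M\<ge>N. coeff_at y M h = 0 \<and> h = (\<Sum>n<M. var y ^ n * coeff_at y n h)"
    using coeff_at_expansion[of y h] ..
  have step: "coeff_at y n h + g * coeff_at y (Suc n) h \<in> ideal_gen B" for n
    using coeff_at_in_ideal_gen[OF B assms(3), of "Suc n"] assms(2)
    by (simp add: distrib_right coeff_at_add coeff_at_Suc_var_mult free_of_def)
  have "coeff_at y n h \<in> ideal_gen B" if "n \<le> N" for n
    using that
  proof (induction rule: inc_induct)
    case base
    then show ?case
      using N by (simp add: ideal_gen_0)
  next
    case (step n)
    then show ?case
      using ideal_gen_diff[OF \<open>coeff_at y n h + g * coeff_at y (Suc n) h \<in> ideal_gen B\<close>
          ideal_gen_mult[of "coeff_at y (Suc n) h" B g]] by simp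
  qed
  then have "(\<Sum>n<N. var y ^ n * coeff_at y n h) \<in> ideal_gen B"
    by (intro ideal_gen_sum ideal_gen_mult) simp
  then show ?thesis
    using N[rule_format, of N] by simp
qed

text \<open>Each form has a private variable \<open>y a\<close>, absent from \<open>B\<close> and
  from the other forms. Adding \<open>f a\<close> to \<open>B\<close> therefore leaves the other
  private variables free.\<close>

lemma weakly_regular_distinct_vars:
  assumes "\<And>a. a \<in> set as \<Longrightarrow> f a = var (y a) + g a"
    and "\<And>a b. a \<in> set as \<Longrightarrow> b \<in> B \<Longrightarrow> free_of (y a) b"
    and "\<And>a b. a \<in> set as \<Longrightarrow> b \<in> set as \<Longrightarrow> free_of (y a) (g b)"
    and "distinct (map y as)"
  shows "weakly_regular B (map f as)"
  using assms
proof (induction as arbitrary: B)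
  case (Cons a as)
  have fa: "f a = var (y a) + g a"
    using Cons.prems(1) by simp
  have "h \<in> ideal_gen B" if "f a * h \<in> ideal_gen B" for h
  proof (rule var_plus_free_regular)
    show "(var (y a) + g a) * h \<in> ideal_gen B"
      using that by (simp add: fa)
  qed (use Cons.prems(2,3) in auto)
  moreover have "free_of (y c) (f a)" if "c \<in> set as" for c
    unfolding fa using that Cons.prems(3,4) by (intro free_of_add free_of_var) auto
  then have "weakly_regular (insert (f a) B) (map f as)"
    using Cons.prems by (intro Cons.IH) auto
  ultimately show ?case
    by simp
qed simp


section \<open>Packings of closed neighbourhoods\<close>

definition neighbours :: "'v set set \<Rightarrow> 'v \<Rightarrow> 'v set"
  where "neighbours E v = {w. {v, w} \<in> E}"

definition closed_neighbours :: "'v set set \<Rightarrow> 'v \<Rightarrow> 'v set"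
  where "closed_neighbours E v = insert v (neighbours E v)"

definition neighbour_sum :: "'v set set \<Rightarrow> 'v \<Rightarrow> ('v, 'k::comm_ring_1) mpoly"
  where "neighbour_sum E a = (\<Sum>v\<in>closed_neighbours E a. var v)"

text \<open>Generators of I(G) together with the variables in \<open>W\<close>. This family is
  closed under both operations of the reduction: adding a variable, and taking the colon by a
  surviving one.\<close>

definition edge_gens :: "'v set set \<Rightarrow> 'v set \<Rightarrow> ('v, 'k::comm_ring_1) mpoly set"
  where "edge_gens E W = var ` W \<union> {var u * var v | u v. {u, v} \<in> E}"

lemma neighbours_sym: "v \<in> neighbours E w \<longleftrightarrow> w \<in> neighbours E v"
  by (simp add: neighbours_def insert_commute)

lemma simple_graph_no_loop: "simple_graph E \<Longrightarrow> v \<notin> neighbours E v"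
  by (auto simp: simple_graph_def neighbours_def)

lemma edge_gens_insert: "insert (var b) (edge_gens E W) = edge_gens E (insert b W)"
  by (auto simp: edge_gens_def)

text \<open>An edge meeting \<open>S\<close> has its other end in \<open>W\<close>, so its monomial
  is redundant. If \<open>S\<close> avoids \<open>W\<close>, the remaining generators are free of
  the variables in \<open>S\<close>.\<close>

lemma ideal_gen_edge_gens_avoiding:
  assumes "\<And>b. b \<in> S \<Longrightarrow> neighbours E b \<subseteq> W"
  shows "ideal_gen (edge_gens E W) =
    ideal_gen (var ` W \<union> {var u * var v | u v. {u, v} \<in> E \<and> u \<notin> S \<and> v \<notin> S})"
    (is "_ = ideal_gen ?B")
proof
  have W: "r * var w \<in> ideal_gen ?B" "var w * r \<in> ideal_gen ?B" if "w \<in> W" for w r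
  proof -
    show "r * var w \<in> ideal_gen ?B"
      using that by (intro ideal_gen_mult ideal_gen_base) simp
    then show "var w * r \<in> ideal_gen ?B"
      by (simp add: mult.commute)
  qed
  have "var u * var v \<in> ideal_gen ?B" if "{u, v} \<in> E" for u v
  proof (cases "u \<in> S \<or> v \<in> S")
    case True
    then have "u \<in> W \<or> v \<in> W"
      using that assms unfolding neighbours_def by (metis insert_commute mem_Collect_eq subsetD)
    then show ?thesis
      using W by blast
  next
    case False
    then show ?thesis
      using that by (intro ideal_gen_base) auto
  qed
  then show "ideal_gen (edge_gens E W) \<subseteq> ideal_gen ?B"
    by (intro ideal_gen_subset) (auto simp: edge_gens_def intro: ideal_gen_base)
  show "ideal_gen ?B \<subseteq> ideal_gen (edge_gens E W)"
    by (rule ideal_gen_mono) (auto simp: edge_gens_def)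
qed

text \<open>Multiplying a neighbour of \<open>b\<close> by \<open>b\<close> gives an edge monomial,
  whence one inclusion. Conversely, modulo the larger ideal the edges at \<open>b\<close> are
  redundant, so its generators can be chosen free of \<open>b\<close> and \<open>b\<close> can be
  cancelled.\<close>

lemma edge_gens_colon:
  assumes "b \<notin> W" and "b \<notin> neighbours E b"
  shows "ideal_gen (edge_gens E (W \<union> neighbours E b)) =
    {h. var b * h \<in> ideal_gen (edge_gens E W :: ('v, 'k::comm_ring_1) mpoly set)}"
proof (intro set_eqI iffI CollectI; (elim CollectE)?)
  fix h :: "('v, 'k) mpoly"
  assume "h \<in> ideal_gen (edge_gens E (W \<union> neighbours E b))"
  then show "var b * h \<in> ideal_gen (edge_gens E W)"
  proof (induction rule: ideal_gen_induct)
    case (mult r g)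
    have "var b * g \<in> ideal_gen (edge_gens E W)"
    proof (cases "g \<in> edge_gens E W")
      case True
      then show ?thesis
        by (intro ideal_gen_mult ideal_gen_base)
    next
      case False
      then show ?thesis
        using mult by (intro ideal_gen_base) (auto simp: edge_gens_def neighbours_def)
    qed
    then have "r * (var b * g) \<in> ideal_gen (edge_gens E W)"
      by (rule ideal_gen_mult)
    then show ?case
      by (simp add: mult_ac)
  qed (simp_all add: ideal_gen_0 distrib_left ideal_gen_add)
next
  fix h :: "('v, 'k) mpoly"
  let ?W = "W \<union> neighbours E b"
  let ?B = "var ` ?W \<union> {var u * var v | u v. {u, v} \<in> E \<and> u \<notin> {b} \<and> v \<notin> {b}} ::
    ('v, 'k) mpoly set"
  have gens: "ideal_gen (edge_gens E ?W) = ideal_gen ?B"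
    by (rule ideal_gen_edge_gens_avoiding) simp
  assume h: "var b * h \<in> ideal_gen (edge_gens E W)"
  have "(edge_gens E W :: ('v, 'k) mpoly set) \<subseteq> edge_gens E ?W"
    by (auto simp: edge_gens_def)
  from subsetD[OF ideal_gen_mono[OF this] h] have "(var b + 0) * h \<in> ideal_gen ?B"
    by (simp add: gens)
  moreover have "free_of b g" if "g \<in> ?B" for g
    using that assms by (auto intro!: free_of_var free_of_mult)
  moreover have "free_of b 0"
    by (simp add: free_of_def)
  ultimately show "h \<in> ideal_gen (edge_gens E ?W)"
    unfolding gens using var_plus_free_regular[of ?B b 0 h] by blast
qed

text \<open>
  The set \<open>W\<close> collects the variables already killed. Splitting off a neighbour \<open>b\<close> of \<open>a\<close> either
  kills \<open>b\<close> (passing to \<open>(J, b)\<close>) or isolates it (passing to \<open>J : b\<close>). Once every closed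
  neighbourhood contains an isolated surviving vertex, all the sums involve private free variables.
\<close>

lemma weakly_regular_neighbour_sums:
  fixes E :: "'v::finite set set"
  assumes "simple_graph E" and "distinct as"
    and "disjoint_family_on (closed_neighbours E) (set as)"
    and "\<And>a. a \<in> set as \<Longrightarrow>
      a \<notin> W \<or> (\<exists>y\<in>closed_neighbours E a. y \<notin> W \<and> neighbours E y \<subseteq> W)"
  shows "weakly_regular (edge_gens E W :: ('v, 'k::comm_ring_1) mpoly set) (map (neighbour_sum E) as)"
  using assms(4)
\<comment> \<open>The measure counts the surviving variables; each branch below kills at least
  one.\<close>
proof (induction "card (- W)" arbitrary: W rule: less_induct)
  case less
  note inv = less.prems
  note noloop = simple_graph_no_loop[OF assms(1)]
  note disj = disjoint_family_onD[OF assms(3)]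
  show ?case
  proof (cases "\<forall>a\<in>set as. \<exists>y\<in>closed_neighbours E a. y \<notin> W \<and> neighbours E y \<subseteq> W")
    case True
    then obtain y where y: "\<And>a. a \<in> set as \<Longrightarrow> y a \<in> closed_neighbours E a"
      "\<And>a. a \<in> set as \<Longrightarrow> y a \<notin> W" "\<And>a. a \<in> set as \<Longrightarrow> neighbours E (y a) \<subseteq> W"
      by metis
    let ?S = "y ` set as"
    let ?B = "var ` W \<union> {var u * var v | u v. {u, v} \<in> E \<and> u \<notin> ?S \<and> v \<notin> ?S} :: ('v, 'k) mpoly set"
    \<comment> \<open>\<open>y b\<close> lies in the closed neighbourhood of \<open>b\<close>, which
      is disjoint from all the others, so it occurs in no other sum.\<close>
    have yinj: "a = b" if "a \<in> set as" "b \<in> set as" "y b \<in> closed_neighbours E a" for a b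
      using disj[of a b] y(1)[of b] that by blast
    have "weakly_regular ?B (map (neighbour_sum E) as)"
    proof (rule weakly_regular_distinct_vars)
      fix a assume a: "a \<in> set as"
      then show "neighbour_sum E a =
          var (y a) + (\<Sum>v\<in>closed_neighbours E a - {y a}. var v)"
        using y(1) by (simp add: neighbour_sum_def sum.remove)
      show "free_of (y a) b" if "b \<in> ?B" for b
        using that y(2) a by (auto intro!: free_of_var free_of_mult)
      show "free_of (y a) (\<Sum>v\<in>closed_neighbours E b - {y b}. var v)" if "b \<in> set as" for b
        using yinj[OF that a] by (auto intro!: free_of_var free_of_sum)
    next
      show "distinct (map y as)"
        unfolding distinct_map using assms(2) yinj y(1) by (metis inj_onI)
    qed
    moreover have "ideal_gen (edge_gens E W) = ideal_gen ?B"
      by (rule ideal_gen_edge_gens_avoiding) (use y(3) in auto)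
    ultimately show ?thesis
      using weakly_regular_cong by blast
  next
    case False
    then obtain a where a: "a \<in> set as"
      and no_y: "\<And>y. y \<in> closed_neighbours E a \<Longrightarrow> y \<notin> W \<Longrightarrow> \<not> neighbours E y \<subseteq> W"
      by blast
    have "a \<notin> W"
      using inv[OF a] no_y by blast
    \<comment> \<open>If all neighbours of \<open>a\<close> were in \<open>W\<close>, then
      \<open>a\<close> itself would be an isolated survivor, contrary to
      \<open>no_y\<close>.\<close>
    then obtain b where b: "b \<in> neighbours E a" "b \<notin> W"
      using no_y[of a] by (auto simp: closed_neighbours_def)
    then have "a \<in> neighbours E b"
      using neighbours_sym by fast
    have b_private: "b \<notin> closed_neighbours E c" if "c \<in> set as" "c \<noteq> a" for c
      using disj[of c a] a b that by (auto simp: closed_neighbours_def)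
    show ?thesis
    proof (rule weakly_regular_colon)
      show "ideal_gen (edge_gens E (W \<union> neighbours E b)) =
          {h. var b * h \<in> ideal_gen (edge_gens E W :: ('v, 'k) mpoly set)}"
        by (rule edge_gens_colon) (use b noloop in auto)
      show "weakly_regular (edge_gens E (W \<union> neighbours E b) :: ('v, 'k) mpoly set)
          (map (neighbour_sum E) as)"
      proof (rule less.hyps)
        show "card (- (W \<union> neighbours E b)) < card (- W)"
          using \<open>a \<notin> W\<close> \<open>a \<in> neighbours E b\<close> by (intro psubset_card_mono) auto
        fix c assume c: "c \<in> set as"
        show "c \<notin> W \<union> neighbours E b \<or> (\<exists>y\<in>closed_neighbours E c.
            y \<notin> W \<union> neighbours E b \<and> neighbours E y \<subseteq> W \<union> neighbours E b)"
        proof (cases "c = a")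
          case True
          \<comment> \<open>In the colon branch \<open>a\<close> is killed, but \<open>b\<close>
            survives with all its neighbours killed and becomes the isolated vertex for
            \<open>a\<close>.\<close>
          then show ?thesis
            using b noloop by (auto simp: closed_neighbours_def)
        next
          case False
          then have "c \<notin> neighbours E b"
            using b_private[OF c] neighbours_sym by (fastforce simp: closed_neighbours_def)
          \<comment> \<open>An isolated survivor has all its neighbours in \<open>W\<close>, whereas
            \<open>b\<close> is outside \<open>W\<close>; so it is not adjacent to \<open>b\<close>
            and survives.\<close>
          moreover have "y \<notin> neighbours E b" if "neighbours E y \<subseteq> W" for y
            using that b neighbours_sym by fast
          ultimately show ?thesis
            using inv[OF c] by blast
        qed
      qed
      show "weakly_regular (insert (var b) (edge_gens E W :: ('v, 'k) mpoly set))
          (map (neighbour_sum E) as)"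
        unfolding edge_gens_insert
      proof (rule less.hyps)
        show "card (- insert b W) < card (- W)"
          using b by (intro psubset_card_mono) auto
        fix c assume c: "c \<in> set as"
        show "c \<notin> insert b W \<or> (\<exists>y\<in>closed_neighbours E c.
            y \<notin> insert b W \<and> neighbours E y \<subseteq> insert b W)"
        proof (cases "c = a")
          case True
          \<comment> \<open>Here only \<open>b\<close> is killed, so \<open>a\<close> survives and
            the first alternative of the invariant holds.\<close>
          then show ?thesis
            using b noloop \<open>a \<notin> W\<close> by auto
        next
          case False
          then show ?thesis
            using inv[OF c] b_private[OF c] by (auto simp: closed_neighbours_def)
        qed
      qed
    qed
  qed
qed

section \<open>Properness and the depth bound from a packing\<close>

text \<open>Constant terms vanish on the ideal, while 1 has constant term 1. This supplies the
  properness in the definition of a regular sequence.\<close>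

lemma maximal_ideal_neq_UNIV: "(maximal_ideal :: ('v, 'k::comm_ring_1) mpoly set) \<noteq> UNIV"
proof -
  have "Poly_Mapping.lookup f 0 = 0" if "f \<in> maximal_ideal" for f :: "('v, 'k) mpoly"
    using that unfolding maximal_ideal_def
  proof (induction rule: ideal_gen_induct)
    case (mult r x)
    then obtain v where x: "x = var v"
      by auto
    have "m + Poly_Mapping.single v (Suc 0) \<noteq> 0" for m
      by (auto simp: poly_mapping_eq_iff fun_eq_iff lookup_add lookup_single when_def)
    then show ?case
      unfolding x
      by (induction r rule: mpoly_induct)
        (simp_all add: var_def mult_single lookup_single distrib_right lookup_add)
  qed (simp_all add: lookup_add)
  moreover have "Poly_Mapping.lookup (1 :: ('v, 'k) mpoly) 0 \<noteq> 0"
    by (simp add: lookup_one)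
  ultimately show ?thesis
    by (metis UNIV_I)
qed

lemma card_packing_le_depth:
  fixes E :: "'v::finite set set"
  assumes "simple_graph E"
    and "disjoint_family_on (closed_neighbours E) A"
  shows "enat (card A) \<le> quotient_depth (edge_ideal E :: ('v, 'k::comm_ring_1) mpoly set)"
proof -
  obtain as where as: "set as = A" "distinct as"
    using finite_distinct_list finite by metis
  let ?fs = "map (neighbour_sum E) as :: ('v, 'k) mpoly list"
  let ?I = "edge_ideal E :: ('v, 'k) mpoly set"
  have gens: "?I = ideal_gen (edge_gens E {})"
    by (simp add: edge_ideal_def edge_gens_def)
  have reg: "weakly_regular ?I ?fs"
  proof (subst weakly_regular_cong)
    show "ideal_gen ?I = ideal_gen (edge_gens E {})"
      unfolding gens by (simp add: ideal_gen_def module.span_span[OF module_times])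
    \<comment> \<open>With nothing killed yet, the invariant holds through its first
      alternative.\<close>
    show "weakly_regular (edge_gens E {}) ?fs"
      by (rule weakly_regular_neighbour_sums) (use assms as in auto)
  qed
  have var_in: "var v \<in> (maximal_ideal :: ('v, 'k) mpoly set)" for v
    unfolding maximal_ideal_def by (intro ideal_gen_base) simp
  have "neighbour_sum E a \<in> (maximal_ideal :: ('v, 'k) mpoly set)" for a
    using var_in unfolding neighbour_sum_def maximal_ideal_def by (intro ideal_gen_sum)
  then have fs: "set ?fs \<subseteq> maximal_ideal"
    by auto
  have "edge_gens E {} \<subseteq> (maximal_ideal :: ('v, 'k) mpoly set)"
    using var_in unfolding edge_gens_def maximal_ideal_def by (auto intro: ideal_gen_mult)
  then have "?I \<subseteq> maximal_ideal"
    unfolding gens maximal_ideal_def by (rule ideal_gen_subset)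
  with fs have "ideal_gen (?I \<union> set ?fs) \<subseteq> maximal_ideal"
    unfolding maximal_ideal_def by (intro ideal_gen_subset) auto
  then have "ideal_gen (?I \<union> set ?fs) \<noteq> UNIV"
    using maximal_ideal_neq_UNIV by auto
  with weakly_regular_nth[OF reg] have "quotient_regular_sequence ?I ?fs"
    unfolding quotient_regular_sequence_def by blast
  with fs have "enat (length ?fs) \<le> quotient_depth ?I"
    unfolding quotient_depth_def by (intro Sup_upper) blast
  then show ?thesis
    using as distinct_card by fastforce
qed


section \<open>Packings from shortest paths\<close>

lemma graph_dist_le: "graph_path E u p v \<Longrightarrow> graph_dist E u v \<le> path_length p"
  unfolding graph_dist_def by (rule Least_le) blast

lemma graph_dist_attained:
  assumes "graph_path E u p v"
  obtains q where "graph_path E u q v" and "path_length q = graph_dist E u v"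
proof -
  have "\<exists>q. graph_path E u q v \<and> path_length q = graph_dist E u v"
    unfolding graph_dist_def by (rule LeastI_ex) (use assms in blast)
  then show ?thesis
    using that by blast
qed

lemma graph_path_step:
  assumes "graph_path E u p v" and "{v, w} \<in> E"
  obtains q where "graph_path E u q w" and "path_length q \<le> Suc (path_length p)"
\<comment> \<open>Paths have distinct vertices: if \<open>w\<close> is already on \<open>p\<close>,
  the path is cut at \<open>w\<close> instead of extended, which is why only an inequality is
  claimed.\<close>
proof (cases "w \<in> set p")
  case True
  then obtain xs ys where p: "p = xs @ w # ys"
    by (meson split_list)
  have "graph_path E u (xs @ [w]) w"
    using assms(1) unfolding p graph_path_def
    by (auto simp: successively_append_iff hd_append)
  moreover have "path_length (xs @ [w]) \<le> Suc (path_length p)"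
    by (simp add: p path_length_def)
  ultimately show ?thesis
    by (rule that)
next
  case False
  then have "graph_path E u (p @ [w]) w"
    using assms unfolding graph_path_def by (auto simp: successively_append_iff)
  moreover have "path_length (p @ [w]) \<le> Suc (path_length p)"
    using assms(1) by (simp add: graph_path_def path_length_def)
  ultimately show ?thesis
    by (rule that)
qed

lemma graph_dist_step:
  assumes "graph_path E u p v" and "{v, w} \<in> E"
  shows "graph_dist E u w \<le> Suc (graph_dist E u v)"
proof -
  obtain q where q: "graph_path E u q v" "path_length q = graph_dist E u v"
    using graph_dist_attained[OF assms(1)] .
  obtain r where "graph_path E u r w" "path_length r \<le> Suc (path_length q)"
    using graph_path_step[OF q(1) assms(2)] .
  with q(2) show ?thesis
    using graph_dist_le le_trans by fastforce
qed

text \<open>The last but one vertex of a shortest path works: truncating the path bounds its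
  distance above, and \<open>graph_dist_step\<close> bounds it below.\<close>

lemma graph_dist_predecessor:
  assumes "graph_path E u p v" and "graph_dist E u v = Suc n"
  obtains w q where "graph_path E u q w" and "graph_dist E u w = n"
proof -
  obtain q where q: "graph_path E u q v" "path_length q = Suc n"
    using graph_dist_attained[OF assms(1)] assms(2) by metis
  then obtain r where r: "q = r @ [v]" "length r = Suc n"
    unfolding graph_path_def path_length_def by (cases q rule: rev_cases) auto
  then have path: "graph_path E u r (last r)" and edge: "{last r, v} \<in> E"
    using q(1) unfolding graph_path_def by (auto simp: successively_append_iff hd_append)
  have "graph_dist E u (last r) \<le> n"
    using graph_dist_le[OF path] r by (simp add: path_length_def)
  moreover have "Suc n \<le> Suc (graph_dist E u (last r))"
    using graph_dist_step[OF path edge] assms(2) by simp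
  ultimately show ?thesis
    using that path by force
qed

lemma graph_dist_level:
  assumes "graph_path E u p v" and "n \<le> graph_dist E u v"
  shows "\<exists>w q. graph_path E u q w \<and> graph_dist E u w = n"
  using assms(2)
proof (induction rule: inc_induct)
  case base
  then show ?case
    using assms(1) by blast
next
  case (step n)
  then obtain w q where "graph_path E u q w" "graph_dist E u w = Suc n"
    by blast
  then obtain w' q' where "graph_path E u q' w'" "graph_dist E u w' = n"
    by (rule graph_dist_predecessor)
  then show ?case
    by blast
qed

section \<open>Connected components and their packings\<close>

text \<open>Transitivity is awkward for paths with distinct vertices; as a reflexive transitive
  closure, connectedness inherits the equivalence properties.\<close>

lemma connected_eq_rtrancl:
  "{(u, v). \<exists>p. graph_path E u p v} = {(u, v). {u, v} \<in> E}\<^sup>*"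
proof (intro set_eqI iffI; clarify)
  fix u p v assume "graph_path E u p v"
  then show "(u, v) \<in> {(u, v). {u, v} \<in> E}\<^sup>*"
  proof (induction p arbitrary: v rule: rev_induct)
    case (snoc x p)
    show ?case
    proof (cases "p = []")
      case True
      then have "u = v"
        using snoc.prems by (auto simp: graph_path_def)
      then show ?thesis
        by simp
    next
      case False
      then have path: "graph_path E u p (last p)" and "{last p, v} \<in> E"
        using snoc.prems by (auto simp: graph_path_def successively_append_iff)
      then have "(last p, v) \<in> {(u, v). {u, v} \<in> E}"
        by simp
      with snoc.IH[OF path] show ?thesis
        by (rule rtrancl_into_rtrancl)
    qed
  qed (simp add: graph_path_def)
next
  fix u v assume "(u, v) \<in> {(u, v). {u, v} \<in> E}\<^sup>*"
  then show "\<exists>p. graph_path E u p v"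
  proof (induction rule: rtrancl_induct)
    case base
    have "graph_path E u [u] u"
      by (simp add: graph_path_def)
    then show ?case ..
  next
    case (step v w)
    then obtain p where "graph_path E u p v" "{v, w} \<in> E"
      by blast
    then obtain q where "graph_path E u q w"
      by (rule graph_path_step)
    then show ?case ..
  qed
qed

lemma equiv_connected: "equiv UNIV {(u, v). \<exists>p. graph_path E u p v}"
proof -
  have "sym {(u, v). {u, v} \<in> E}"
    by (rule symI) (simp add: insert_commute)
  then show ?thesis
    unfolding connected_eq_rtrancl by (intro equivI refl_rtrancl sym_rtrancl trans_rtrancl) simp
qed

text \<open>Starting from an end \<open>u\<close> of a diametral pair, a vertex at distance
  \<open>3 * k\<close> has its closed neighbourhood within distances \<open>3 * k - 1\<close> to
  \<open>3 * k + 1\<close>. These ranges are disjoint for different \<open>k\<close>.\<close>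

lemma component_packing:
  fixes E :: "'v::finite set set"
  assumes C: "C \<in> components E"
  shows "\<exists>A\<subseteq>C. card A = component_diameter E C div 3 + 1 \<and>
    disjoint_family_on (closed_neighbours E) A"
proof -
  note quotient = C[unfolded components_def]
  define D where "D = {graph_dist E u v | u v. u \<in> C \<and> v \<in> C}"
  have "C \<noteq> {}"
    using in_quotient_imp_non_empty[OF equiv_connected quotient] .
  then have "D \<noteq> {}"
    by (auto simp: D_def)
  moreover have "D = (\<lambda>(u, v). graph_dist E u v) ` (C \<times> C)"
    by (auto simp: D_def)
  then have "finite D"
    by simp
  ultimately have "Max D \<in> D"
    by (intro Max_in)
  then obtain u v where uv: "u \<in> C" "v \<in> C" "graph_dist E u v = component_diameter E C"
    by (auto simp: D_def component_diameter_def)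
  then obtain p where p: "graph_path E u p v"
    using in_quotient_imp_in_rel[OF equiv_connected quotient, of u v] by blast
  let ?n = "component_diameter E C div 3"
  \<comment> \<open>One vertex is chosen at each of the distances 0, 3, 6 and so on. They need not
    lie on one geodesic, since only distances from \<open>u\<close> are compared.\<close>
  have "\<exists>w q. graph_path E u q w \<and> graph_dist E u w = 3 * k" if "k \<le> ?n" for k
    using that uv(3) by (intro graph_dist_level[OF p]) simp
  then obtain w q where w: "\<And>k. k \<le> ?n \<Longrightarrow> graph_path E u (q k) (w k)"
    "\<And>k. k \<le> ?n \<Longrightarrow> graph_dist E u (w k) = 3 * k"
    by metis
  have "w ` {..?n} \<subseteq> C"
    using w(1) uv(1) in_quotient_imp_closed[OF equiv_connected quotient] by blast
  moreover have "inj_on w {..?n}"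
    using w(2) by (intro inj_onI) (metis atMost_iff mult_cancel1 zero_neq_numeral)
  then have "card (w ` {..?n}) = ?n + 1"
    by (simp add: card_image)
  moreover have "disjoint_family_on (closed_neighbours E) (w ` {..?n})"
    unfolding disjoint_family_on_def
  proof (intro ballI impI, rule ccontr)
    fix a b assume ab: "a \<in> w ` {..?n}" "b \<in> w ` {..?n}" "a \<noteq> b"
    \<comment> \<open>The lower bound is stated with \<open>Suc\<close> on the right to avoid
      truncated subtraction at \<open>k = 0\<close>.\<close>
    have near: "graph_dist E u z \<le> Suc (3 * k) \<and> 3 * k \<le> Suc (graph_dist E u z)"
      if k: "k \<le> ?n" and z: "z \<in> closed_neighbours E (w k)" for k z
    proof (cases "z = w k")
      case True
      then show ?thesis
        using w(2)[OF k] by simp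
    next
      case False
      then have edge: "{w k, z} \<in> E" "{z, w k} \<in> E"
        using z by (auto simp: closed_neighbours_def neighbours_def insert_commute)
      \<comment> \<open>A path to \<open>z\<close> allows the edge to be used backwards, from
        \<open>z\<close> to \<open>w k\<close>, for the lower bound.\<close>
      obtain r where r: "graph_path E u r z"
        using graph_path_step[OF w(1)[OF k] edge(1)] .
      show ?thesis
        using graph_dist_step[OF w(1)[OF k] edge(1)] graph_dist_step[OF r edge(2)]
          w(2)[OF k] by simp
    qed
    obtain i j where ij: "i \<le> ?n" "j \<le> ?n" "a = w i" "b = w j"
      using ab by auto
    assume "closed_neighbours E a \<inter> closed_neighbours E b \<noteq> {}"
    then obtain z where "z \<in> closed_neighbours E (w i)" "z \<in> closed_neighbours E (w j)"
      using ij by blast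
    then have "i = j"
      using near[OF ij(1)] near[OF ij(2)] by fastforce
    with ij ab show False
      by simp
  qed
  ultimately show ?thesis
    by blast
qed

lemma nat_ceiling_Suc_div_3: "nat \<lceil>(real d + 1) / 3\<rceil> = d div 3 + 1"
proof -
  have "d = 3 * (d div 3) + d mod 3" "d mod 3 \<le> 2"
    by auto
  then have "real d \<le> 3 * real (d div 3) + 2" "3 * real (d div 3) \<le> real d"
    by linarith+
  \<comment> \<open>With q = d div 3, the number (d + 1) / 3 lies above q and is at most q +
    1.\<close>
  then have "\<lceil>(real d + 1) / 3\<rceil> = int (d div 3) + 1"
    by (intro ceiling_unique) (simp_all add: field_simps)
  then show ?thesis
    by simp
qed

theorem corollary3p3:
  fixes E :: "'v::finite set set"
    and I :: "('v, 'k::field) mpoly set"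
  assumes "simple_graph E"
    and "no_isolated_vertices E"
    and "I = edge_ideal E"
  shows "quotient_depth I
           \<ge> enat (\<Sum>C\<in>components E. nat \<lceil>(real (component_diameter E C) + 1) / 3\<rceil>)
       \<and> quotient_depth I
           \<ge> enat (nat \<lceil>(real (graph_diameter E) + 1) / 3\<rceil> + card (components E) - 1)"
proof -
  let ?t = "\<lambda>C. component_diameter E C div 3 + 1"
  obtain A where A: "\<And>C. C \<in> components E \<Longrightarrow> A C \<subseteq> C"
    "\<And>C. C \<in> components E \<Longrightarrow> card (A C) = ?t C"
    "\<And>C. C \<in> components E \<Longrightarrow> disjoint_family_on (closed_neighbours E) (A C)"
    using component_packing[of _ E] by metis
  have disj: "C \<inter> C' = {}" if "C \<in> components E" "C' \<in> components E" "C \<noteq> C'" for C C'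
    using quotient_disj[OF equiv_connected] that unfolding components_def by blast
  \<comment> \<open>Closed neighbourhoods stay inside their component, so packings of different
    components can be united.\<close>
  have closed: "z \<in> C" if "C \<in> components E" "a \<in> C" "z \<in> closed_neighbours E a" for a z C
  proof -
    have "(a, z) \<in> {(u, v). {u, v} \<in> E}\<^sup>*"
      using that by (auto simp: closed_neighbours_def neighbours_def)
    then show ?thesis
      using in_quotient_imp_closed[OF equiv_connected that(1)[unfolded components_def] that(2)]
      unfolding connected_eq_rtrancl by blast
  qed
  have "card (\<Union>C\<in>components E. A C) = (\<Sum>C\<in>components E. ?t C)"
  proof (subst card_UN_disjoint)
    show "\<forall>C\<in>components E. \<forall>C'\<in>components E. C \<noteq> C' \<longrightarrow> A C \<inter> A C' = {}"
      using A(1) disj by blast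
  qed (simp_all add: A(2))
  moreover have "enat (card (\<Union>C\<in>components E. A C)) \<le> quotient_depth I"
    unfolding assms(3)
  proof (rule card_packing_le_depth[OF assms(1)], unfold disjoint_family_on_def, intro ballI impI)
    fix a b assume "a \<in> (\<Union>C\<in>components E. A C)" "b \<in> (\<Union>C\<in>components E. A C)" "a \<noteq> b"
    then obtain C C' where C: "C \<in> components E" "C' \<in> components E" "a \<in> A C" "b \<in> A C'"
      by blast
    show "closed_neighbours E a \<inter> closed_neighbours E b = {}"
    proof (cases "C = C'")
      case True
      then show ?thesis
        using A(3)[OF C(1)] C \<open>a \<noteq> b\<close> by (auto dest: disjoint_family_onD)
    next
      case False
      then show ?thesis
        using closed A(1) C disj by blast
    qed
  qed
  ultimately have depth: "enat (\<Sum>C\<in>components E. ?t C) \<le> quotient_depth I"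
    by simp
  have "components E \<noteq> {}"
    by (simp add: components_def quotient_def)
  then have "graph_diameter E \<in> component_diameter E ` components E"
    unfolding graph_diameter_def by (intro Max_in) auto
  then obtain C where C: "C \<in> components E" "graph_diameter E = component_diameter E C"
    by blast
  \<comment> \<open>Every component contributes at least 1; applied to all except one of maximal
    diameter, this gives the summand p - 1.\<close>
  have "card (components E - {C}) \<le> (\<Sum>C\<in>components E - {C}. ?t C)"
    using sum_mono[of "components E - {C}" "\<lambda>_. 1" ?t] by simp
  then have "?t C + card (components E) - 1 \<le> (\<Sum>C\<in>components E. ?t C)"
    using C(1) by (simp add: sum.remove[of _ C])
  then have "enat (?t C + card (components E) - 1) \<le> quotient_depth I"
    using depth by (meson enat_ord_simps(1) order_trans)
  with depth C(2) show ?thesis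
    by (simp only: nat_ceiling_Suc_div_3 simp_thms)
qed

end
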